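(* Let $\mu$ be a probabilistic frame for $\mathbb{R}^n$ with frame bounds $0<A\le B$, and let $\nu\in\mathcal{P}_2(\mathbb{R}^n)$ be a probabilistic dual frame of $\mu$. Then $$\int_{\mathbb{R}^n}\int_{\mathbb{R}^n}|\langle{\bf x},{\bf y}\rangle|^2\,d\mu({\bf x})\,d\nu({\bf y})\ \ge\ \frac{A}{B}\,n,$$ and equality holds if and only if $\mu$ is a tight probabilistic frame (that is, $A=B$) and $\nu=({\bf S}_\mu^{-1})_\#\mu$.
   Context: $\mathcal{P}(\mathbb{R}^n)$ is the set of Borel probability measures on $\mathbb{R}^n$, and $\mathcal{P}_2(\mathbb{R}^n)$ is the subset of those with finite second moment. A measure $\mu\in\mathcal{P}(\mathbb{R}^n)$ is a probabilistic frame for $\mathbb{R}^n$ with (frame) bounds $0<A\le B<\infty$ if $A\|{\bf x}\|^2\le\int_{\mathbb{R}^n}|\langle{\bf x},{\bf y}\rangle|^2d\mu({\bf y})\le B\|{\bf x}\|^2$ for all ${\bf x}\in\mathbb{R}^n$; it is tight if $A=B$. Its frame operator is the (positive definite) matrix ${\bf S}_\mu=\int_{\mathbb{R}^n}{\bf y}{\bf y}^t\,d\mu({\bf y})$. $\Gamma(\mu,\nu)$ is the set of Borel probability measures on $\mathbb{R}^n\times\mathbb{R}^n$ with first marginal $\mu$ and second marginal $\nu$. A measure $\nu\in\mathcal{P}_2(\mathbb{R}^n)$ is a probabilistic dual frame of $\mu$ if there exists $\gamma\in\Gamma(\mu,\nu)$ with $\int_{\mathbb{R}^n\times\mathbb{R}^n}{\bf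 x}{\bf y}^t\,d\gamma({\bf x},{\bf y})={\bf Id}$, the $n\times n$ identity matrix. $({\bf S}_\mu^{-1})_\#\mu$ is the pushforward of $\mu$ under the linear map ${\bf x}\mapsto{\bf S}_\mu^{-1}{\bf x}$ (the canonical probabilistic dual frame). The double integral is called the probabilistic dual frame potential $\mathrm{PDFP}_\mu(\nu)$. *)

theory Defs
  imports "HOL-Probability.Probability"
begin

definition borel_probs :: "'a::topological_space measure set" where
  "borel_probs = {M. sets M = sets borel \<and> prob_space M}"

definition borel_probs2 :: "'a::real_normed_vector measure set" where
  "borel_probs2 = {M \<in> borel_probs. integrable M (\<lambda>x. (norm x)\<^sup>2)}"

text \<open>
  The integrand below and in the dual frame potential is nonnegative, so the extended nonnegative
  integral is used: it is meaningful without an integrability hypothesis, and the upper bound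
  includes finiteness.
\<close>

definition prob_frame :: "(real^'n) measure \<Rightarrow> real \<Rightarrow> real \<Rightarrow> bool" where
  "prob_frame \<mu> A B \<longleftrightarrow> \<mu> \<in> borel_probs \<and> 0 < A \<and> A \<le> B \<and>
    (\<forall>x. ennreal (A * (norm x)\<^sup>2) \<le> (\<integral>\<^sup>+ y. ennreal (\<bar>x \<bullet> y\<bar>\<^sup>2) \<partial>\<mu>) \<and>
         (\<integral>\<^sup>+ y. ennreal (\<bar>x \<bullet> y\<bar>\<^sup>2) \<partial>\<mu>) \<le> ennreal (B * (norm x)\<^sup>2))"

text \<open>Tightness refers to the given bounds, which need not be the optimal ones.\<close>

definition tight_prob_frame :: "(real^'n) measure \<Rightarrow> real \<Rightarrow> real \<Rightarrow> bool" where
  "tight_prob_frame \<mu> A B \<longleftrightarrow> prob_frame \<mu> A B \<and> A = B"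

definition outer_product :: "real^'n \<Rightarrow> real^'n \<Rightarrow> real^'n^'n" where
  "outer_product x y = (\<chi> i j. x $ i * y $ j)"

text \<open>For a probabilistic frame the integrand is integrable, by the upper frame bound.\<close>

definition frame_operator :: "(real^'n) measure \<Rightarrow> real^'n^'n" where
  "frame_operator \<mu> = (\<integral>y. outer_product y y \<partial>\<mu>)"

definition couplings ::
  "'a::topological_space measure \<Rightarrow> 'b::topological_space measure \<Rightarrow> ('a \<times> 'b) measure set" where
  "couplings \<mu> \<nu> = {\<gamma> \<in> borel_probs. distr \<gamma> borel fst = \<mu> \<and> distr \<gamma> borel snd = \<nu>}"

definition prob_dual_frame :: "(real^'n) measure \<Rightarrow> (real^'n) measure \<Rightarrow> bool" where
  "prob_dual_frame \<mu> \<nu> \<longleftrightarrow> \<nu> \<in> borel_probs2 \<and>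
    (\<exists>\<gamma> \<in> couplings \<mu> \<nu>. has_bochner_integral \<gamma> (\<lambda>(x, y). outer_product x y) (mat 1))"

definition canonical_dual :: "(real^'n) measure \<Rightarrow> (real^'n) measure" where
  "canonical_dual \<mu> = distr \<mu> borel (\<lambda>x. matrix_inv (frame_operator \<mu>) *v x)"

definition dual_frame_potential :: "(real^'n) measure \<Rightarrow> (real^'n) measure \<Rightarrow> ennreal" where
  "dual_frame_potential \<mu> \<nu> = (\<integral>\<^sup>+ y. (\<integral>\<^sup>+ x. ennreal (\<bar>x \<bullet> y\<bar>\<^sup>2) \<partial>\<mu>) \<partial>\<nu>)"

end

theory Submission
  imports Defs
begin

text \<open>
  Let \<open>n\<close> be the dimension and let \<open>\<gamma>\<close> be a coupling that witnesses duality. Taking traces in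
  \<open>\<integral> x y\<^sup>t d\<gamma> = Id\<close> gives \<open>\<integral> x \<bullet> y d\<gamma> = n\<close>, while summing the upper frame
  bound over an orthonormal basis gives \<open>\<integral> |x|\<^sup>2 d\<mu> \<le> n B\<close>. Completing the square,
  \<open>0 \<le> \<integral> |y - x/B|\<^sup>2 d\<gamma> \<le> \<integral> |y|\<^sup>2 d\<nu> - n/B\<close>
  (lemma \<open>dual_coupling_distance\<close>). So the second moment of every dual frame is at least \<open>n/B\<close>,
  and the lower frame bound, applied to each fixed \<open>y\<close>, shows that the potential is at least
  \<open>A\<close> times this second moment.

  In the case of equality the square must vanish, so \<open>\<gamma>\<close> is carried by the graph of \<open>x \<mapsto> x/B\<close>.
  Duality then says that \<open>\<integral> x x\<^sup>t d\<mu> = B Id\<close>, hence \<open>\<mu>\<close> also has the bounds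
  \<open>B, B\<close>, the canonical dual is the image of \<open>\<mu>\<close> under \<open>x \<mapsto> x/B\<close>, which is \<open>\<nu>\<close>, and
  the potential equals \<open>n\<close>, which forces \<open>A = B\<close>. Conversely, for a tight frame polarization
  gives \<open>S = A Id\<close>, so the canonical dual is the image of \<open>\<mu>\<close> under \<open>x \<mapsto> x/A\<close>; its second
  moment is \<open>n A / A\<^sup>2\<close>, and the potential is \<open>A\<close> times that.
\<close>

section \<open>Second moments and tight frames\<close>

lemma power2_norm_eq_sum_axis:
  fixes x :: "real^'n"
  shows "(norm x)\<^sup>2 = (\<Sum>i\<in>UNIV. (axis i 1 \<bullet> x)\<^sup>2)"
  unfolding power2_norm_eq_inner
  by (simp add: inner_vec_def[of x x] inner_axis' power2_eq_square)

lemma nn_integral_power2_norm_eq_sum_axis: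
  fixes \<mu> :: "(real^'n) measure"
  assumes "sets \<mu> = sets borel"
  shows "(\<integral>\<^sup>+ x. ennreal ((norm x)\<^sup>2) \<partial>\<mu>) =
    (\<Sum>i\<in>UNIV. \<integral>\<^sup>+ x. ennreal (\<bar>axis i 1 \<bullet> x\<bar>\<^sup>2) \<partial>\<mu>)"
proof -
  have [measurable_cong]: "sets \<mu> = sets borel" by fact
  have "(\<integral>\<^sup>+ x. ennreal ((norm x)\<^sup>2) \<partial>\<mu>) =
      (\<integral>\<^sup>+ x. (\<Sum>i\<in>UNIV. ennreal (\<bar>axis i 1 \<bullet> x\<bar>\<^sup>2)) \<partial>\<mu>)"
    by (simp add: power2_norm_eq_sum_axis sum_ennreal)
  also have "\<dots> = (\<Sum>i\<in>UNIV. \<integral>\<^sup>+ x. ennreal (\<bar>axis i 1 \<bullet> x\<bar>\<^sup>2) \<partial>\<mu>)"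
    by (rule nn_integral_sum) measurable
  finally show ?thesis .
qed

lemma prob_frame_second_moment_le:
  fixes \<mu> :: "(real^'n) measure"
  assumes "prob_frame \<mu> A B"
  shows "(\<integral>\<^sup>+ x. ennreal ((norm x)\<^sup>2) \<partial>\<mu>) \<le> ennreal (real CARD('n) * B)"
proof -
  have \<mu>: "sets \<mu> = sets borel" and B: "0 < B"
    using assms by (auto simp: prob_frame_def borel_probs_def)
  have "(\<integral>\<^sup>+ x. ennreal ((norm x)\<^sup>2) \<partial>\<mu>) \<le> (\<Sum>i\<in>(UNIV::'n set). ennreal (B * (norm (axis i 1 :: real^'n))\<^sup>2))"
    unfolding nn_integral_power2_norm_eq_sum_axis[OF \<mu>]
    using assms unfolding prob_frame_def by (intro sum_mono) blast
  also have "\<dots> = ennreal (real CARD('n) * B)"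
    using B by (simp add: norm_axis_1 ennreal_mult ennreal_of_nat_eq_real_of_nat)
  finally show ?thesis .
qed

lemma tight_frame_nn_integral_inner:
  assumes "prob_frame \<mu> c c"
  shows "(\<integral>\<^sup>+ y. ennreal (\<bar>x \<bullet> y\<bar>\<^sup>2) \<partial>\<mu>) = ennreal (c * (norm x)\<^sup>2)"
  using assms by (auto simp: prob_frame_def intro: antisym)

lemma tight_frame_second_moment:
  fixes \<mu> :: "(real^'n) measure"
  assumes "prob_frame \<mu> c c"
  shows "(\<integral>\<^sup>+ x. ennreal ((norm x)\<^sup>2) \<partial>\<mu>) = ennreal (real CARD('n) * c)"
proof -
  have \<mu>: "sets \<mu> = sets borel" and c: "0 < c"
    using assms by (auto simp: prob_frame_def borel_probs_def)
  show ?thesis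
    unfolding nn_integral_power2_norm_eq_sum_axis[OF \<mu>] tight_frame_nn_integral_inner[OF assms]
    using c by (simp add: norm_axis_1 ennreal_mult ennreal_of_nat_eq_real_of_nat)
qed

lemma scaleR_axis_axis_component:
  "((a *\<^sub>R axis i (axis j 1)) :: real^'n^'m) $ k $ l = (if l = j then if k = i then a else 0 else 0)"
  by (simp add: axis_def)

text \<open>
  Expanding matrices in the basis of matrix units reduces the matrix-valued integral
  \<open>\<integral> y y\<^sup>t d\<mu>\<close> to finitely many scalar integrals.
\<close>

lemma outer_product_eq_sum_axis:
  fixes x y :: "real^'n"
  shows "outer_product x y =
    (\<Sum>i\<in>UNIV. \<Sum>j\<in>UNIV. ((axis i 1 \<bullet> x) * (axis j 1 \<bullet> y)) *\<^sub>R axis i (axis j 1))"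
  unfolding vec_eq_iff sum_component scaleR_axis_axis_component
  by (simp add: outer_product_def inner_axis')

lemma mat_eq_sum_axis:
  "(mat c :: real^'n^'n) =
    (\<Sum>i\<in>UNIV. \<Sum>j\<in>UNIV. (c * (axis i 1 \<bullet> (axis j 1 :: real^'n))) *\<^sub>R axis i (axis j 1))"
  unfolding vec_eq_iff sum_component scaleR_axis_axis_component
  by (simp add: mat_def inner_axis_axis)

text \<open>
  A tight frame prescribes only the quadratic form of its frame operator. Polarization recovers
  every matrix entry from it, and the same identity supplies the integrability of the entries.
\<close>

lemma tight_frame_operator:
  fixes \<mu> :: "(real^'n) measure"
  assumes fr: "prob_frame \<mu> c c"
  shows "frame_operator \<mu> = mat c"
proof -
  have [measurable_cong]: "sets \<mu> = sets borel" and c: "0 < c"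
    using fr by (auto simp: prob_frame_def borel_probs_def)
  have sq: "has_bochner_integral \<mu> (\<lambda>y. (z \<bullet> y)\<^sup>2) (c * (norm z)\<^sup>2)" for z
    using tight_frame_nn_integral_inner[OF fr, of z] c
    by (intro has_bochner_integral_nn_integral) auto
  have entry: "has_bochner_integral \<mu> (\<lambda>y. (u \<bullet> y) * (v \<bullet> y)) (c * (u \<bullet> v))" for u v
  proof -
    have "has_bochner_integral \<mu> (\<lambda>y. (((u + v) \<bullet> y)\<^sup>2 - ((u - v) \<bullet> y)\<^sup>2) * (1/4))
        ((c * (norm (u + v))\<^sup>2 - c * (norm (u - v))\<^sup>2) * (1/4))"
      by (intro has_bochner_integral_mult_left has_bochner_integral_diff sq)
    also have "(\<lambda>y. (((u + v) \<bullet> y)\<^sup>2 - ((u - v) \<bullet> y)\<^sup>2) * (1/4)) = (\<lambda>y. (u \<bullet> y) * (v \<bullet> y))"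
      by (simp add: fun_eq_iff power2_eq_square algebra_simps)
    also have "(c * (norm (u + v))\<^sup>2 - c * (norm (u - v))\<^sup>2) * (1/4) = c * (u \<bullet> v)"
      by (simp add: power2_norm_eq_inner algebra_simps inner_commute)
    finally show ?thesis .
  qed
  have "has_bochner_integral \<mu> (\<lambda>y. outer_product y y) (mat c)"
    unfolding outer_product_eq_sum_axis mat_eq_sum_axis
    by (intro has_bochner_integral_sum has_bochner_integral_scaleR_left entry)
  then show ?thesis
    unfolding frame_operator_def by (rule has_bochner_integral_integral_eq)
qed

lemma mat_vector_mult: "mat c *v x = c *\<^sub>R (x :: real^'n)"
proof -
  have "mat c = c *\<^sub>R (mat 1 :: real^'n^'n)"
    by (simp add: mat_def vec_eq_iff)
  then show ?thesis
    by (simp add: scaleR_matrix_vector_assoc[symmetric])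
qed

lemma matrix_inv_mat_vector_mult:
  fixes x :: "real^'n"
  assumes "c \<noteq> 0"
  shows "matrix_inv (mat c) *v x = x /\<^sub>R c"
proof -
  have "\<exists>M :: real^'n^'n. mat c ** M = mat 1 \<and> M ** mat c = mat 1"
    using assms
    by (intro exI[of _ "mat (inverse c)"])
      (simp add: matrix_eq matrix_vector_mul_assoc[symmetric] mat_vector_mult)
  then have "matrix_inv (mat c) ** mat c = (mat 1 :: real^'n^'n)"
    unfolding matrix_inv_def by (rule someI2_ex) simp
  then have "matrix_inv (mat c) *v (mat c *v (x /\<^sub>R c)) = x /\<^sub>R c"
    unfolding matrix_vector_mul_assoc by simp
  then show ?thesis
    using assms by (simp add: mat_vector_mult)
qed

lemma tight_frame_canonical_dual:
  assumes "prob_frame \<mu> c c"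
  shows "canonical_dual \<mu> = distr \<mu> borel (\<lambda>x. x /\<^sub>R c)"
proof -
  have "c \<noteq> 0" using assms by (auto simp: prob_frame_def)
  then show ?thesis
    unfolding canonical_dual_def tight_frame_operator[OF assms]
    by (intro distr_cong) (simp_all add: matrix_inv_mat_vector_mult)
qed

section \<open>The potential of a dual frame\<close>

lemma dual_frame_potential_ge_second_moment:
  assumes "prob_frame \<mu> A B" "\<nu> \<in> borel_probs"
  shows "dual_frame_potential \<mu> \<nu> \<ge> ennreal A * (\<integral>\<^sup>+ y. ennreal ((norm y)\<^sup>2) \<partial>\<nu>)"
proof -
  have [measurable_cong]: "sets \<nu> = sets borel" and A: "0 < A"
    using assms by (auto simp: prob_frame_def borel_probs_def)
  have "ennreal A * (\<integral>\<^sup>+ y. ennreal ((norm y)\<^sup>2) \<partial>\<nu>) = (\<integral>\<^sup>+ y. ennreal (A * (norm y)\<^sup>2) \<partial>\<nu>)"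
    using A by (simp add: nn_integral_cmult ennreal_mult)
  also have "\<dots> \<le> dual_frame_potential \<mu> \<nu>"
    unfolding dual_frame_potential_def
    using assms(1) by (intro nn_integral_mono) (auto simp: prob_frame_def inner_commute)
  finally show ?thesis .
qed

lemma tight_dual_frame_potential:
  assumes "prob_frame \<mu> c c" "\<nu> \<in> borel_probs"
  shows "dual_frame_potential \<mu> \<nu> = ennreal c * (\<integral>\<^sup>+ y. ennreal ((norm y)\<^sup>2) \<partial>\<nu>)"
proof -
  have [measurable_cong]: "sets \<nu> = sets borel" and c: "0 < c"
    using assms by (auto simp: prob_frame_def borel_probs_def)
  have "dual_frame_potential \<mu> \<nu> = (\<integral>\<^sup>+ y. ennreal (c * (norm y)\<^sup>2) \<partial>\<nu>)"
    unfolding dual_frame_potential_def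
    using tight_frame_nn_integral_inner[OF assms(1)] by (simp add: inner_commute)
  then show ?thesis
    using c by (simp add: nn_integral_cmult ennreal_mult)
qed

lemma tight_canonical_dual_potential:
  fixes \<mu> :: "(real^'n) measure"
  assumes fr: "prob_frame \<mu> c c"
  shows "dual_frame_potential \<mu> (canonical_dual \<mu>) = ennreal (real CARD('n))"
proof -
  have [measurable_cong]: "sets \<mu> = sets borel" and c: "0 < c" and p: "prob_space \<mu>"
    using fr by (auto simp: prob_frame_def borel_probs_def)
  have "canonical_dual \<mu> \<in> borel_probs"
    unfolding tight_frame_canonical_dual[OF fr] borel_probs_def
    using p by (auto intro!: prob_space.prob_space_distr)
  then have "dual_frame_potential \<mu> (canonical_dual \<mu>)
      = ennreal c * (\<integral>\<^sup>+ y. ennreal ((norm y)\<^sup>2) \<partial>canonical_dual \<mu>)"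
    by (rule tight_dual_frame_potential[OF fr])
  also have "(\<integral>\<^sup>+ y. ennreal ((norm y)\<^sup>2) \<partial>canonical_dual \<mu>)
      = (\<integral>\<^sup>+ x. ennreal ((norm (x /\<^sub>R c))\<^sup>2) \<partial>\<mu>)"
    unfolding tight_frame_canonical_dual[OF fr] by (subst nn_integral_distr) auto
  also have "(\<integral>\<^sup>+ x. ennreal ((norm (x /\<^sub>R c))\<^sup>2) \<partial>\<mu>)
      = ennreal ((inverse c)\<^sup>2) * (\<integral>\<^sup>+ x. ennreal ((norm x)\<^sup>2) \<partial>\<mu>)"
    using c by (simp add: power_mult_distrib ennreal_mult nn_integral_cmult)
  also have "ennreal c * \<dots> = ennreal (real CARD('n))"
    unfolding tight_frame_second_moment[OF fr]
    using c by (simp add: ennreal_mult[symmetric] power2_eq_square field_simps)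
  finally show ?thesis .
qed

text \<open>The inner product with the identity matrix is the trace.\<close>

lemma outer_product_inner_mat: "outer_product x y \<bullet> mat 1 = x \<bullet> y"
  by (simp add: outer_product_def mat_def inner_vec_def if_distrib cong: if_cong)

lemma inner_outer_product_self_mult: "z \<bullet> (outer_product x x *v z) = (z \<bullet> x)\<^sup>2"
  by (simp add: outer_product_def matrix_vector_mult_def inner_vec_def power2_eq_square
      sum_distrib_left sum_distrib_right mult_ac)

text \<open>
  For an optimal pair \<open>y\<close> has to equal \<open>x/B\<close>, hence the choice of centre. After expansion the cross
  term is \<open>-2n/B\<close> by the trace identity, and the term \<open>\<integral> |x|\<^sup>2 d\<mu> / B\<^sup>2\<close>, being at most
  \<open>n/B\<close>, takes back at most half of it.
\<close>

lemma dual_coupling_distance: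
  fixes \<mu> \<nu> :: "(real^'n) measure"
  assumes fr: "prob_frame \<mu> A B" and \<nu>: "\<nu> \<in> borel_probs2"
    and \<gamma>: "\<gamma> \<in> couplings \<mu> \<nu>"
    and dual: "has_bochner_integral \<gamma> (\<lambda>(x, y). outer_product x y) (mat 1)"
  shows "integrable \<gamma> (\<lambda>p. (norm (snd p - fst p /\<^sub>R B))\<^sup>2)" (is ?int)
    and "(\<integral>p. (norm (snd p - fst p /\<^sub>R B))\<^sup>2 \<partial>\<gamma>) \<le> (\<integral>y. (norm y)\<^sup>2 \<partial>\<nu>) - real CARD('n) / B" (is ?le)
proof -
  have [measurable_cong]: "sets \<mu> = sets borel" "sets \<nu> = sets borel" "sets \<gamma> = sets borel"
    and B: "0 < B"
    and m1: "distr \<gamma> borel fst = \<mu>" and m2: "distr \<gamma> borel snd = \<nu>"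
    using assms by (auto simp: prob_frame_def borel_probs_def borel_probs2_def couplings_def)
  have [measurable]: "fst \<in> measurable \<gamma> borel" "snd \<in> measurable \<gamma> borel"
    by (auto intro!: borel_measurable_continuous_onI continuous_intros
        simp: measurable_cong_sets[OF \<open>sets \<gamma> = sets borel\<close> refl])
  have i\<mu>: "integrable \<mu> (\<lambda>x. (norm x)\<^sup>2)"
    using prob_frame_second_moment_le[OF fr]
    by (intro integrableI_bounded) (auto simp: order_le_less_trans)
  have t: "(\<integral>x. (norm x)\<^sup>2 \<partial>\<mu>) \<le> real CARD('n) * B"
    using prob_frame_second_moment_le[OF fr] B i\<mu>
    by (simp add: nn_integral_eq_integral)
  have marginal: "has_bochner_integral \<gamma> (\<lambda>p. (norm (g p))\<^sup>2) (\<integral>x. (norm x)\<^sup>2 \<partial>distr \<gamma> borel g)"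
    if [measurable]: "g \<in> measurable \<gamma> borel" and "integrable (distr \<gamma> borel g) (\<lambda>x. (norm x)\<^sup>2)"
    for g :: "(real^'n) \<times> (real^'n) \<Rightarrow> real^'n"
    using that(2) by (simp add: has_bochner_integral_iff integrable_distr_eq integral_distr)
  have x2: "has_bochner_integral \<gamma> (\<lambda>p. (norm (fst p))\<^sup>2) (\<integral>x. (norm x)\<^sup>2 \<partial>\<mu>)"
    using marginal[of fst] i\<mu> by (simp add: m1)
  have y2: "has_bochner_integral \<gamma> (\<lambda>p. (norm (snd p))\<^sup>2) (\<integral>y. (norm y)\<^sup>2 \<partial>\<nu>)"
    using marginal[of snd] \<nu> by (simp add: m2 borel_probs2_def)
  have "has_bochner_integral \<gamma> (\<lambda>p. (case p of (x, y) \<Rightarrow> outer_product x y) \<bullet> mat 1)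
      ((mat 1 :: real^'n^'n) \<bullet> mat 1)"
    using dual by (intro has_bochner_integral_inner_left)
  moreover have "(mat 1 :: real^'n^'n) \<bullet> mat 1 = real CARD('n)"
    by (simp add: mat_def inner_vec_def if_distrib cong: if_cong)
  ultimately have xy: "has_bochner_integral \<gamma> (\<lambda>p. fst p \<bullet> snd p) (real CARD('n))"
    by (simp add: case_prod_beta outer_product_inner_mat)
  have "has_bochner_integral \<gamma>
      (\<lambda>p. (norm (snd p))\<^sup>2 - 2 / B * (fst p \<bullet> snd p) + (1 / B\<^sup>2) * (norm (fst p))\<^sup>2)
      ((\<integral>y. (norm y)\<^sup>2 \<partial>\<nu>) - 2 / B * real CARD('n) + (1 / B\<^sup>2) * (\<integral>x. (norm x)\<^sup>2 \<partial>\<mu>))"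
    by (intro has_bochner_integral_add has_bochner_integral_diff has_bochner_integral_mult_right x2 y2 xy)
  also have "(\<lambda>p. (norm (snd p))\<^sup>2 - 2 / B * (fst p \<bullet> snd p) + (1 / B\<^sup>2) * (norm (fst p))\<^sup>2)
      = (\<lambda>p. (norm (snd p - fst p /\<^sub>R B))\<^sup>2)"
    using B unfolding power2_norm_eq_inner fun_eq_iff
    by (auto simp: inner_diff_left inner_diff_right inner_commute power2_eq_square field_simps)
  finally have *: "has_bochner_integral \<gamma> (\<lambda>p. (norm (snd p - fst p /\<^sub>R B))\<^sup>2)
      ((\<integral>y. (norm y)\<^sup>2 \<partial>\<nu>) - 2 / B * real CARD('n) + (1 / B\<^sup>2) * (\<integral>x. (norm x)\<^sup>2 \<partial>\<mu>))" .
  then show ?int by (auto simp: has_bochner_integral_iff)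
  have "(1 / B\<^sup>2) * (\<integral>x. (norm x)\<^sup>2 \<partial>\<mu>) \<le> (1 / B\<^sup>2) * (real CARD('n) * B)"
    using t B by (intro mult_left_mono) auto
  also have "\<dots> = real CARD('n) / B" using B by (simp add: power2_eq_square)
  finally show ?le using * by (simp add: has_bochner_integral_iff)
qed

text \<open>
  Equality in the completed square puts the coupling on the graph of \<open>x \<mapsto> x/B\<close>. The duality
  identity then reads \<open>\<integral> x x\<^sup>t d\<mu> = B Id\<close>, and the quadratic form of this matrix is the
  tight frame condition.
\<close>

lemma dual_frame_minimal_second_moment:
  fixes \<mu> \<nu> :: "(real^'n) measure"
  assumes fr: "prob_frame \<mu> A B" and \<nu>: "\<nu> \<in> borel_probs2"
    and pd: "prob_dual_frame \<mu> \<nu>"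
    and le: "(\<integral>y. (norm y)\<^sup>2 \<partial>\<nu>) \<le> real CARD('n) / B"
  shows "prob_frame \<mu> B B" and "\<nu> = distr \<mu> borel (\<lambda>x. x /\<^sub>R B)"
proof -
  from pd obtain \<gamma> where \<gamma>: "\<gamma> \<in> couplings \<mu> \<nu>"
    and dual: "has_bochner_integral \<gamma> (\<lambda>(x, y). outer_product x y) (mat 1)"
    by (auto simp: prob_dual_frame_def)
  have [measurable_cong]: "sets \<mu> = sets borel" "sets \<gamma> = sets borel"
    and B: "0 < B" and p: "\<mu> \<in> borel_probs"
    and m1: "distr \<gamma> borel fst = \<mu>" and m2: "distr \<gamma> borel snd = \<nu>"
    using fr \<gamma> by (auto simp: prob_frame_def borel_probs_def couplings_def)
  have [measurable]: "fst \<in> measurable \<gamma> borel" "snd \<in> measurable \<gamma> borel"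
    by (auto intro!: borel_measurable_continuous_onI continuous_intros
        simp: measurable_cong_sets[OF \<open>sets \<gamma> = sets borel\<close> refl])
  note dist = dual_coupling_distance[OF fr \<nu> \<gamma> dual]
  have "(\<integral>p. (norm (snd p - fst p /\<^sub>R B))\<^sup>2 \<partial>\<gamma>) = 0"
    using dist(2) le by (intro antisym) auto
  then have "AE p in \<gamma>. (norm (snd p - fst p /\<^sub>R B))\<^sup>2 = 0"
    using dist(1) by (subst (asm) integral_nonneg_eq_0_iff_AE) auto
  then have ae: "AE p in \<gamma>. snd p = fst p /\<^sub>R B"
    by eventually_elim simp
  have "\<nu> = distr \<gamma> borel (\<lambda>p. fst p /\<^sub>R B)"
    unfolding m2[symmetric] using ae by (intro distr_cong_AE) auto
  also have "\<dots> = distr \<mu> borel (\<lambda>x. x /\<^sub>R B)"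
    unfolding m1[symmetric] by (subst distr_distr) (auto simp: o_def)
  finally show "\<nu> = distr \<mu> borel (\<lambda>x. x /\<^sub>R B)" .

  have form: "(\<integral>\<^sup>+ x. ennreal (\<bar>z \<bullet> x\<bar>\<^sup>2) \<partial>\<mu>) = ennreal (B * (norm z)\<^sup>2)" for z
  proof -
    have lin: "bounded_linear (\<lambda>M :: real^'n^'n. z \<bullet> (M *v z))"
      by (intro bounded_linear_compose[OF bounded_linear_inner_right]
          linear_conv_bounded_linear[THEN iffD1] linearI)
        (auto simp: matrix_vector_mult_add_rdistrib scaleR_matrix_vector_assoc)
    have "has_bochner_integral \<gamma> (\<lambda>p. z \<bullet> ((case p of (x, y) \<Rightarrow> outer_product x y) *v z))
        (z \<bullet> (mat 1 *v z))"
      by (rule has_bochner_integral_bounded_linear[OF lin dual])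
    then have scaled: "has_bochner_integral \<gamma> (\<lambda>p. B * (z \<bullet> (outer_product (fst p) (snd p) *v z)))
        (B * (norm z)\<^sup>2)"
      by (intro has_bochner_integral_mult_right) (simp add: case_prod_beta power2_norm_eq_inner)
    have graph: "AE p in \<gamma>. B * (z \<bullet> (outer_product (fst p) (snd p) *v z)) = (z \<bullet> fst p)\<^sup>2"
      using ae
    proof eventually_elim
      case (elim p)
      have "outer_product (fst p) (fst p /\<^sub>R B) = outer_product (fst p) (fst p) /\<^sub>R B"
        by (simp add: outer_product_def vec_eq_iff mult_ac)
      with elim B show ?case
        by (simp add: scaleR_matrix_vector_assoc[symmetric] inner_outer_product_self_mult)
    qed
    have "has_bochner_integral \<gamma> (\<lambda>p. (z \<bullet> fst p)\<^sup>2) (B * (norm z)\<^sup>2)"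
      by (rule has_bochner_integral_cong_AE[THEN iffD1,
            OF borel_measurable_has_bochner_integral[OF scaled] _ graph scaled]) measurable
    then have "(\<integral>\<^sup>+ p. ennreal (\<bar>z \<bullet> fst p\<bar>\<^sup>2) \<partial>\<gamma>) = ennreal (B * (norm z)\<^sup>2)"
      by (simp add: has_bochner_integral_iff nn_integral_eq_integral)
    then show ?thesis
      unfolding m1[symmetric] by (subst nn_integral_distr) auto
  qed
  show "prob_frame \<mu> B B"
    using B p by (simp only: prob_frame_def form) auto
qed

theorem theorem3p7:
  fixes \<mu> \<nu> :: "(real^'n) measure" and A B :: real
  assumes "prob_frame \<mu> A B"
    and "\<nu> \<in> borel_probs2"
    and "prob_dual_frame \<mu> \<nu>"
  shows "dual_frame_potential \<mu> \<nu> \<ge> ennreal (A / B * real CARD('n)) \<and>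
    (dual_frame_potential \<mu> \<nu> = ennreal (A / B * real CARD('n)) \<longleftrightarrow>
      tight_prob_frame \<mu> A B \<and> \<nu> = canonical_dual \<mu>)"
proof -
  have A: "0 < A" and B: "0 < B" and p: "\<nu> \<in> borel_probs"
    and i\<nu>: "integrable \<nu> (\<lambda>y. (norm y)\<^sup>2)"
    using assms by (auto simp: prob_frame_def borel_probs2_def)
  define r where "r = (\<integral>y. (norm y)\<^sup>2 \<partial>\<nu>)"
  have ge: "dual_frame_potential \<mu> \<nu> \<ge> ennreal (A * r)"
    using dual_frame_potential_ge_second_moment[OF assms(1) p] i\<nu> A
    by (simp add: nn_integral_eq_integral r_def ennreal_mult)
  from assms(3) obtain \<gamma> where \<gamma>: "\<gamma> \<in> couplings \<mu> \<nu>"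
    and dual: "has_bochner_integral \<gamma> (\<lambda>(x, y). outer_product x y) (mat 1)"
    by (auto simp: prob_dual_frame_def)
  have "0 \<le> (\<integral>p. (norm (snd p - fst p /\<^sub>R B))\<^sup>2 \<partial>\<gamma>)" by simp
  also have "\<dots> \<le> r - real CARD('n) / B"
    unfolding r_def by (rule dual_coupling_distance(2)[OF assms(1,2) \<gamma> dual])
  finally have "A * (real CARD('n) / B) \<le> A * r"
    using A by (intro mult_left_mono) auto
  then have lower: "ennreal (A / B * real CARD('n)) \<le> dual_frame_potential \<mu> \<nu>"
    using ge by (auto intro: order_trans[OF ennreal_leI])
  have "tight_prob_frame \<mu> A B \<and> \<nu> = canonical_dual \<mu>"
    if eq: "dual_frame_potential \<mu> \<nu> = ennreal (A / B * real CARD('n))"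
  proof -
    have "A * r \<le> A * (real CARD('n) / B)"
      using ge A B unfolding eq by simp
    then have "r \<le> real CARD('n) / B" using A by (simp only: mult_le_cancel_left_pos)
    note min = dual_frame_minimal_second_moment[OF assms this[unfolded r_def]]
    have can: "\<nu> = canonical_dual \<mu>"
      using min tight_frame_canonical_dual by metis
    have "ennreal (A / B * real CARD('n)) = ennreal (real CARD('n))"
      using tight_canonical_dual_potential[OF min(1)] can eq by simp
    then have "A / B * real CARD('n) = real CARD('n)" using A B by simp
    then have "A / B = 1" unfolding mult_cancel_right2 by simp
    then have "A = B" using B by simp
    with assms(1) can show ?thesis by (simp add: tight_prob_frame_def)
  qed
  moreover have "dual_frame_potential \<mu> \<nu> = ennreal (A / B * real CARD('n))"
    if "tight_prob_frame \<mu> A B \<and> \<nu> = canonical_dual \<mu>"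
    using that tight_canonical_dual_potential[of \<mu> A] A by (auto simp: tight_prob_frame_def)
  ultimately show ?thesis using lower by blast
qed

end
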